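(* Let $q\in\mathbb{C}$ with $0<|q|<1$ and let $t_1,t_2$ be nonzero complex numbers. For every integer $n\ge 0$ define $$\chi^{(q)}_n(t_1,t_2)=\sum_{\substack{n_1,n_2\ge 0\\ n_1+n_2=n}}\frac{t_1^{-n_1}t_2^{-n_2}}{(n_1)_q!\,(n_2)_q!},$$ and put $\chi^{(q)}_{-1}(t_1,t_2)=0$. Then $\Psi^{(q)}_{t_1,t_2}(n)=\chi^{(q)}_n(t_1,t_2)$ is a solution of the eigenfunction equation of the $q$-deformed $\mathfrak{gl}_2$-Toda chain on the lattice, i.e. for every integer $n\ge 0$ $$t_1^{-1}t_2^{-1}\,\Psi^{(q)}_{t_1,t_2}(n-1)+(1-q^{n+1})\,\Psi^{(q)}_{t_1,t_2}(n+1)=(t_1^{-1}+t_2^{-1})\,\Psi^{(q)}_{t_1,t_2}(n).$$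
   Context: Here $(n)_q!=(1-q)(1-q^2)\cdots(1-q^n)$ for $n\ge 1$ and $(0)_q!=1$. The displayed difference equation is the form in which the $q$-deformed $\mathfrak{gl}_2$-Toda eigenfunction problem on the lattice is written; its solution $\Psi^{(q)}_{t_1,t_2}$ is called the lattice ($q$-deformed) $\mathfrak{gl}_2$-Whittaker function. *)

theory Defs
  imports Complex_Main
begin

definition qfact :: "complex \<Rightarrow> nat \<Rightarrow> complex" where
  "qfact q n = (\<Prod>k=1..n. 1 - q ^ k)"

(* The index is an integer so that n = -1 is available; the convention that the value
   at -1 is 0 is extended to all negative indices, which are never used.
   For n \<ge> 0 the index set of the sum is finite. *)
definition qchi :: "complex \<Rightarrow> complex \<Rightarrow> complex \<Rightarrow> int \<Rightarrow> complex" where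
  "qchi q t1 t2 n =
     (if n < 0 then 0
      else \<Sum>(n1, n2) \<in> {(n1 :: nat, n2 :: nat). int n1 + int n2 = n}.
             (t1 powi (- int n1) * t2 powi (- int n2)) / (qfact q n1 * qfact q n2))"

definition gl2_qToda_eigenfunction ::
    "complex \<Rightarrow> complex \<Rightarrow> complex \<Rightarrow> (int \<Rightarrow> complex) \<Rightarrow> bool" where
  "gl2_qToda_eigenfunction q t1 t2 \<Psi> \<longleftrightarrow>
     (\<forall>n :: int. n \<ge> 0 \<longrightarrow>
        inverse t1 * inverse t2 * \<Psi> (n - 1) + (1 - q powi (n + 1)) * \<Psi> (n + 1)
          = (inverse t1 + inverse t2) * \<Psi> n)"

end

(* With a = 1/t1 and b = 1/t2, the numbers qchi n are the coefficients of the product of the two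
   q-exponential series E_a(z) = sum_n a^n z^n / (n)_q! and E_b(z). The operator
   D f(z) = f(z) - f(qz) satisfies D E_a = a z E_a and the twisted Leibniz rule
   D(f g) = D f g + f D g - D f D g, so H = E_a E_b satisfies D H = ((a + b) z - a b z^2) H.
   The coefficient of z^(n+1) in this identity is the Toda equation. *)
theory Submission
  imports Defs "HOL-Computational_Algebra.Formal_Power_Series"
begin

unbundle fps_syntax

text \<open>This is the operator D, since replacing z by q z scales the n-th coefficient by
  \<open>q ^ n\<close>.\<close>

definition fps_qdiff :: "'a::comm_ring_1 \<Rightarrow> 'a fps \<Rightarrow> 'a fps" where
  "fps_qdiff q f = Abs_fps (\<lambda>n. (1 - q ^ n) * f $ n)"

lemma fps_qdiff_nth [simp]: "fps_qdiff q f $ n = (1 - q ^ n) * f $ n"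
  by (simp add: fps_qdiff_def)

text \<open>Coefficientwise this is 1 - x y = (1 - x) + (1 - y) - (1 - x) (1 - y) with x =
  \<open>q ^ i\<close> and y = \<open>q ^ (n - i)\<close>.\<close>

lemma fps_qdiff_mult:
  "fps_qdiff q (f * g) = fps_qdiff q f * g + f * fps_qdiff q g - fps_qdiff q f * fps_qdiff q g"
proof (rule fps_ext)
  fix n
  have "(1 - q ^ n) * (f $ i * g $ (n - i)) =
      (1 - q ^ i) * f $ i * g $ (n - i) + f $ i * ((1 - q ^ (n - i)) * g $ (n - i))
        - (1 - q ^ i) * f $ i * ((1 - q ^ (n - i)) * g $ (n - i))" if "i \<le> n" for i
  proof -
    have "q ^ n = q ^ i * q ^ (n - i)"
      using that by (simp flip: power_add)
    then show ?thesis by (simp add: algebra_simps)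
  qed
  then show "fps_qdiff q (f * g) $ n =
      (fps_qdiff q f * g + f * fps_qdiff q g - fps_qdiff q f * fps_qdiff q g) $ n"
    by (simp add: fps_mult_nth sum_distrib_left flip: sum.distrib sum_subtractf)
qed

definition fps_qexp :: "complex \<Rightarrow> complex \<Rightarrow> complex fps" where
  "fps_qexp q a = Abs_fps (\<lambda>n. a ^ n / qfact q n)"

text \<open>The factor \<open>1 - q ^ Suc m\<close> cancels the last factor of
  \<open>qfact q (Suc m)\<close>; the assumption makes it nonzero.\<close>

lemma fps_qdiff_qexp:
  assumes "\<And>n. n > 0 \<Longrightarrow> q ^ n \<noteq> 1"
  shows "fps_qdiff q (fps_qexp q a) = fps_const a * fps_X * fps_qexp q a"
proof (rule fps_ext)
  fix n
  show "fps_qdiff q (fps_qexp q a) $ n = (fps_const a * fps_X * fps_qexp q a) $ n"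
  proof (cases n)
    case (Suc m)
    have "1 - q ^ Suc m \<noteq> 0"
      using assms[of "Suc m"] by simp
    moreover have "qfact q (Suc m) = qfact q m * (1 - q ^ Suc m)"
      by (simp add: qfact_def)
    ultimately show ?thesis
      using Suc by (simp add: fps_qexp_def mult.assoc)
  qed (simp add: mult.assoc)
qed

lemma qchi_eq_fps_nth:
  "qchi q t1 t2 (int n) = (fps_qexp q (inverse t1) * fps_qexp q (inverse t2)) $ n"
proof -
  \<comment> \<open>Indexing the pairs by their first entry turns the sum in \<open>qchi\<close>
    into a Cauchy product.\<close>
  have "{(n1, n2). int n1 + int n2 = int n} = (\<lambda>i. (i, n - i)) ` {0..n}"
    by (auto simp: image_iff)
  moreover have "inj_on (\<lambda>i. (i, n - i)) {0..n}"
    by (auto simp: inj_on_def)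
  ultimately show ?thesis
    by (simp add: qchi_def fps_mult_nth fps_qexp_def sum.reindex power_int_minus
        power_inverse)
qed

theorem mainTheorem1:
  fixes q t1 t2 :: complex
  assumes "0 < cmod q" and "cmod q < 1"
    and "t1 \<noteq> 0" and "t2 \<noteq> 0"
  shows "gl2_qToda_eigenfunction q t1 t2 (qchi q t1 t2)"
  unfolding gl2_qToda_eigenfunction_def
proof (intro allI impI)
  fix n :: int
  assume "n \<ge> 0"
  then obtain m where n: "n = int m"
    using nonneg_int_cases by blast
  define a where "a = inverse t1"
  define b where "b = inverse t2"
  define H where "H = fps_qexp q a * fps_qexp q b"
  \<comment> \<open>A root of unity has modulus 1, which \<open>cmod q < 1\<close> excludes.\<close>
  have qpow: "q ^ k \<noteq> 1" if "k > 0" for k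
  proof
    assume "q ^ k = 1"
    then have "cmod q ^ k = 1"
      by (metis norm_one norm_power)
    then show False
      using power_less_one_iff[of "cmod q" k] assms(2) that by simp
  qed
  have "fps_qdiff q (fps_qexp q c) = fps_const c * fps_X * fps_qexp q c" for c
    using fps_qdiff_qexp qpow by blast
  then have "fps_qdiff q H = fps_const (a + b) * (fps_X * H) - fps_const (a * b) * (fps_X * (fps_X * H))"
    by (simp add: H_def fps_qdiff_mult algebra_simps flip: fps_const_add fps_const_mult)
  then have "fps_qdiff q H $ Suc m =
      (fps_const (a + b) * (fps_X * H) - fps_const (a * b) * (fps_X * (fps_X * H))) $ Suc m"
    by simp
  \<comment> \<open>The factor \<open>fps_X\<close> stays in the first term, so that m = 0 needs no
    separate equation.\<close>
  then have "a * b * (fps_X * H) $ m + (1 - q ^ Suc m) * H $ Suc m = (a + b) * H $ m"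
    by simp
  moreover have H: "qchi q t1 t2 (int k) = H $ k" for k
    by (simp add: qchi_eq_fps_nth H_def a_def b_def)
  \<comment> \<open>For m = 0 both sides vanish: the convention for \<open>qchi\<close> at -1
    matches the zero constant term of \<open>fps_X * H\<close>.\<close>
  moreover have "qchi q t1 t2 (n - 1) = (fps_X * H) $ m"
    using H by (cases m) (simp_all add: n qchi_def)
  moreover have "n + 1 = int (Suc m)"
    by (simp add: n)
  ultimately show "inverse t1 * inverse t2 * qchi q t1 t2 (n - 1) +
      (1 - q powi (n + 1)) * qchi q t1 t2 (n + 1) = (inverse t1 + inverse t2) * qchi q t1 t2 n"
    by (simp only: n power_int_of_nat flip: a_def b_def)
qed

end
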